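(* Let $\Gamma=(F,G,\eta,\rho)$ be a right wide Morita context between the abelian categories $\mathcal A$ and $\mathcal B$ (so $F:\mathcal B\to\mathcal A$, $G:\mathcal A\to\mathcal B$), such that the functors $F$ and $G$ have right adjoints $F':\mathcal A\to\mathcal B$ and $G':\mathcal B\to\mathcal A$. Let $\mathcal C_\Gamma\subseteq\mathcal A$ and $\mathcal D_\Gamma\subseteq\mathcal B$ be the full subcategories associated with $\eta$ and $\rho$ respectively. Then the full subcategory of $\mathcal C_\Gamma$-closed objects of $\mathcal A$ and the full subcategory of $\mathcal D_\Gamma$-closed objects of $\mathcal B$ are equivalent via the functors $F'$ and $G'$ (restricted to these subcategories).
   Context: All functors are additive; subcategory means full subcategory. A right wide Morita context between abelian categories $\mathcal A$ and $\mathcal B$ is a datum $(F,G,\eta,\rho)$ where $F:\mathcal B\to\mathcal A$ and $G:\mathcal A\to\mathcal B$ are right exact functors and $\eta:F\circ G\to 1_{\mathcal A}$, $\rho:G\circ F\to 1_{\mathcal B}$ are natural transformations with $G\eta=\rho G$ and $F\rho=\eta F$. $\mathcal C_\Gamma=\{X\in\mathcal A \mid f\circ\eta(M)=0 \text{ for every } M\in\mathcal A \text{ and every } f:M\to X\}$, and similarly $\mathcal D_\Gamma=\{Y\in\mathcal B\mid f\circ\rho(N)=0 \text{ for every } N\in\mathcal B\text{ and every } f:N\to Y\}$. For a subcategory $\mathcal C$ of an abelian category $\mathcal A$, an object $M$ is $\mathcal C$-torsion free if for any $X\in\mathcal C$ and any monomorphism $X\to M$ one has $X=0$. $M$ is $\mathcal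 C$-injective if for every monomorphism $i:X'\to X$ in $\mathcal A$ with $X/X'\in\mathcal C$ and every morphism $f:X'\to M$ there is $g:X\to M$ with $g\circ i=f$. $M$ is $\mathcal C$-closed if it is $\mathcal C$-torsion free and $\mathcal C$-injective. *)

theory Defs
  imports "HOL-Algebra.Group"
begin

section \<open>Categories with an addition on arrows\<close>

record ('o, 'm) cat =
  Ob :: "'o set"
  Arr :: "'m set"
  Dom :: "'m \<Rightarrow> 'o"
  Cod :: "'m \<Rightarrow> 'o"
  Id :: "'o \<Rightarrow> 'm"
  Comp :: "'m \<Rightarrow> 'm \<Rightarrow> 'm"  (infixr \<open>\<cdot>\<index>\<close> 70)
  Sum :: "'m \<Rightarrow> 'm \<Rightarrow> 'm"
  Zero :: "'o \<Rightarrow> 'o \<Rightarrow> 'm"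

definition homset :: "('o, 'm) cat \<Rightarrow> 'o \<Rightarrow> 'o \<Rightarrow> 'm set" where
  "homset C x y = {f \<in> Arr C. Dom C f = x \<and> Cod C f = y}"

locale category =
  fixes C :: "('o, 'm) cat" (structure)
  assumes Dom_in_Ob: "f \<in> Arr C \<Longrightarrow> Dom C f \<in> Ob C"
    and Cod_in_Ob: "f \<in> Arr C \<Longrightarrow> Cod C f \<in> Ob C"
    and Id_in_homset: "x \<in> Ob C \<Longrightarrow> Id C x \<in> homset C x x"
    and Comp_in_homset: "\<lbrakk>f \<in> homset C x y; g \<in> homset C y z\<rbrakk> \<Longrightarrow> g \<cdot> f \<in> homset C x z"
    and Comp_Id: "f \<in> homset C x y \<Longrightarrow> f \<cdot> Id C x = f"
    and Id_Comp: "f \<in> homset C x y \<Longrightarrow> Id C y \<cdot> f = f"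
    and Comp_assoc: "\<lbrakk>f \<in> homset C w x; g \<in> homset C x y; h \<in> homset C y z\<rbrakk>
      \<Longrightarrow> (h \<cdot> g) \<cdot> f = h \<cdot> (g \<cdot> f)"

definition hom_group :: "('o, 'm) cat \<Rightarrow> 'o \<Rightarrow> 'o \<Rightarrow> 'm monoid" where
  "hom_group C x y = \<lparr>carrier = homset C x y, mult = Sum C, one = Zero C x y\<rparr>"

locale preadditive_category = category +
  assumes hom_comm_group: "\<lbrakk>x \<in> Ob C; y \<in> Ob C\<rbrakk> \<Longrightarrow> comm_group (hom_group C x y)"
    and Comp_Sum_right: "\<lbrakk>f \<in> homset C x y; f' \<in> homset C x y; g \<in> homset C y z\<rbrakk>
      \<Longrightarrow> g \<cdot> Sum C f f' = Sum C (g \<cdot> f) (g \<cdot> f')"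
    and Comp_Sum_left: "\<lbrakk>f \<in> homset C x y; g \<in> homset C y z; g' \<in> homset C y z\<rbrakk>
      \<Longrightarrow> Sum C g g' \<cdot> f = Sum C (g \<cdot> f) (g' \<cdot> f)"


section \<open>Abelian categories\<close>

definition mono_arr :: "('o, 'm) cat \<Rightarrow> 'm \<Rightarrow> bool" where
  "mono_arr C f \<longleftrightarrow> f \<in> Arr C \<and>
    (\<forall>w \<in> Ob C. \<forall>g \<in> homset C w (Dom C f). \<forall>h \<in> homset C w (Dom C f).
      f \<cdot>\<^bsub>C\<^esub> g = f \<cdot>\<^bsub>C\<^esub> h \<longrightarrow> g = h)"

definition epi_arr :: "('o, 'm) cat \<Rightarrow> 'm \<Rightarrow> bool" where
  "epi_arr C f \<longleftrightarrow> f \<in> Arr C \<and>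
    (\<forall>z \<in> Ob C. \<forall>g \<in> homset C (Cod C f) z. \<forall>h \<in> homset C (Cod C f) z.
      g \<cdot>\<^bsub>C\<^esub> f = h \<cdot>\<^bsub>C\<^esub> f \<longrightarrow> g = h)"

definition iso_arr :: "('o, 'm) cat \<Rightarrow> 'm \<Rightarrow> bool" where
  "iso_arr C f \<longleftrightarrow> f \<in> Arr C \<and>
    (\<exists>g \<in> homset C (Cod C f) (Dom C f).
      g \<cdot>\<^bsub>C\<^esub> f = Id C (Dom C f) \<and> f \<cdot>\<^bsub>C\<^esub> g = Id C (Cod C f))"

definition zero_object :: "('o, 'm) cat \<Rightarrow> 'o \<Rightarrow> bool" where
  "zero_object C z \<longleftrightarrow> z \<in> Ob C \<and>
    (\<forall>x \<in> Ob C. (\<exists>!f. f \<in> homset C x z) \<and> (\<exists>!f. f \<in> homset C z x))"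

definition is_kernel :: "('o, 'm) cat \<Rightarrow> 'm \<Rightarrow> 'm \<Rightarrow> bool" where
  "is_kernel C k f \<longleftrightarrow> f \<in> Arr C \<and> k \<in> Arr C \<and> Cod C k = Dom C f \<and>
    f \<cdot>\<^bsub>C\<^esub> k = Zero C (Dom C k) (Cod C f) \<and>
    (\<forall>w \<in> Ob C. \<forall>h \<in> homset C w (Dom C f). f \<cdot>\<^bsub>C\<^esub> h = Zero C w (Cod C f)
      \<longrightarrow> (\<exists>!u. u \<in> homset C w (Dom C k) \<and> k \<cdot>\<^bsub>C\<^esub> u = h))"

definition is_cokernel :: "('o, 'm) cat \<Rightarrow> 'm \<Rightarrow> 'm \<Rightarrow> bool" where
  "is_cokernel C p f \<longleftrightarrow> f \<in> Arr C \<and> p \<in> Arr C \<and> Dom C p = Cod C f \<and>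
    p \<cdot>\<^bsub>C\<^esub> f = Zero C (Dom C f) (Cod C p) \<and>
    (\<forall>z \<in> Ob C. \<forall>h \<in> homset C (Cod C f) z. h \<cdot>\<^bsub>C\<^esub> f = Zero C (Dom C f) z
      \<longrightarrow> (\<exists>!u. u \<in> homset C (Cod C p) z \<and> u \<cdot>\<^bsub>C\<^esub> p = h))"

definition is_biproduct ::
  "('o, 'm) cat \<Rightarrow> 'o \<Rightarrow> 'o \<Rightarrow> 'o \<Rightarrow> 'm \<Rightarrow> 'm \<Rightarrow> 'm \<Rightarrow> 'm \<Rightarrow> bool" where
  "is_biproduct C x y b i j p q \<longleftrightarrow> b \<in> Ob C \<and>
    i \<in> homset C x b \<and> j \<in> homset C y b \<and> p \<in> homset C b x \<and> q \<in> homset C b y \<and>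
    p \<cdot>\<^bsub>C\<^esub> i = Id C x \<and> q \<cdot>\<^bsub>C\<^esub> j = Id C y \<and>
    q \<cdot>\<^bsub>C\<^esub> i = Zero C x y \<and> p \<cdot>\<^bsub>C\<^esub> j = Zero C y x \<and>
    Sum C (i \<cdot>\<^bsub>C\<^esub> p) (j \<cdot>\<^bsub>C\<^esub> q) = Id C b"

locale abelian_category = preadditive_category +
  assumes zero_object_exists: "\<exists>z. zero_object C z"
    and biproduct_exists: "\<lbrakk>x \<in> Ob C; y \<in> Ob C\<rbrakk> \<Longrightarrow> \<exists>b i j p q. is_biproduct C x y b i j p q"
    and kernel_exists: "f \<in> Arr C \<Longrightarrow> \<exists>k. is_kernel C k f"
    and cokernel_exists: "f \<in> Arr C \<Longrightarrow> \<exists>p. is_cokernel C p f"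
    and mono_is_kernel: "mono_arr C f \<Longrightarrow> \<exists>g. is_kernel C f g"
    and epi_is_cokernel: "epi_arr C f \<Longrightarrow> \<exists>g. is_cokernel C f g"

text \<open>
  Exactness of \<open>x \<rightarrow> y \<rightarrow> z\<close> at \<open>y\<close>: the image of the first arrow, i.e. the kernel \<open>m\<close> of its
  cokernel \<open>p\<close>, is a kernel of the second.
\<close>

definition exact_at :: "('o, 'm) cat \<Rightarrow> 'm \<Rightarrow> 'm \<Rightarrow> bool" where
  "exact_at C f g \<longleftrightarrow> f \<in> Arr C \<and> g \<in> Arr C \<and> Cod C f = Dom C g \<and>
    (\<exists>p m. is_cokernel C p f \<and> is_kernel C m p \<and> is_kernel C m g)"


section \<open>Functors, natural transformations, adjoints, equivalences\<close>

record ('o, 'm, 'p, 'n) fun_data =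
  ob_map :: "'o \<Rightarrow> 'p"
  arr_map :: "'m \<Rightarrow> 'n"

definition is_functor ::
  "('o, 'm) cat \<Rightarrow> ('p, 'n) cat \<Rightarrow> ('o, 'm, 'p, 'n) fun_data \<Rightarrow> bool" where
  "is_functor C D F \<longleftrightarrow>
    (\<forall>x \<in> Ob C. ob_map F x \<in> Ob D) \<and>
    (\<forall>f \<in> Arr C. arr_map F f \<in> homset D (ob_map F (Dom C f)) (ob_map F (Cod C f))) \<and>
    (\<forall>x \<in> Ob C. arr_map F (Id C x) = Id D (ob_map F x)) \<and>
    (\<forall>f \<in> Arr C. \<forall>g \<in> Arr C. Dom C g = Cod C f
      \<longrightarrow> arr_map F (g \<cdot>\<^bsub>C\<^esub> f) = arr_map F g \<cdot>\<^bsub>D\<^esub> arr_map F f)"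

definition id_fun :: "('o, 'm, 'o, 'm) fun_data" where
  "id_fun = \<lparr>ob_map = (\<lambda>x. x), arr_map = (\<lambda>f. f)\<rparr>"

definition comp_fun ::
  "('p, 'n, 'q, 'k) fun_data \<Rightarrow> ('o, 'm, 'p, 'n) fun_data \<Rightarrow> ('o, 'm, 'q, 'k) fun_data"
  (infixl \<open>\<circ>\<^sub>F\<close> 55) where
  "G \<circ>\<^sub>F F = \<lparr>ob_map = ob_map G \<circ> ob_map F, arr_map = arr_map G \<circ> arr_map F\<rparr>"

definition additive_functor ::
  "('o, 'm) cat \<Rightarrow> ('p, 'n) cat \<Rightarrow> ('o, 'm, 'p, 'n) fun_data \<Rightarrow> bool" where
  "additive_functor C D F \<longleftrightarrow> is_functor C D F \<and>
    (\<forall>x \<in> Ob C. \<forall>y \<in> Ob C. \<forall>f \<in> homset C x y. \<forall>g \<in> homset C x y.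
      arr_map F (Sum C f g) = Sum D (arr_map F f) (arr_map F g))"

definition right_exact_functor ::
  "('o, 'm) cat \<Rightarrow> ('p, 'n) cat \<Rightarrow> ('o, 'm, 'p, 'n) fun_data \<Rightarrow> bool" where
  "right_exact_functor C D F \<longleftrightarrow> additive_functor C D F \<and>
    (\<forall>f g. mono_arr C f \<and> exact_at C f g \<and> epi_arr C g
      \<longrightarrow> exact_at D (arr_map F f) (arr_map F g) \<and> epi_arr D (arr_map F g))"

definition nat_trans ::
  "('o, 'm) cat \<Rightarrow> ('p, 'n) cat \<Rightarrow> ('o, 'm, 'p, 'n) fun_data \<Rightarrow> ('o, 'm, 'p, 'n) fun_data
    \<Rightarrow> ('o \<Rightarrow> 'n) \<Rightarrow> bool" where
  "nat_trans C D F G \<tau> \<longleftrightarrow>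
    (\<forall>x \<in> Ob C. \<tau> x \<in> homset D (ob_map F x) (ob_map G x)) \<and>
    (\<forall>f \<in> Arr C. \<tau> (Cod C f) \<cdot>\<^bsub>D\<^esub> arr_map F f = arr_map G f \<cdot>\<^bsub>D\<^esub> \<tau> (Dom C f))"

definition nat_isomorphic ::
  "('o, 'm) cat \<Rightarrow> ('p, 'n) cat \<Rightarrow> ('o, 'm, 'p, 'n) fun_data \<Rightarrow> ('o, 'm, 'p, 'n) fun_data
    \<Rightarrow> bool" where
  "nat_isomorphic C D F G \<longleftrightarrow>
    (\<exists>\<tau>. nat_trans C D F G \<tau> \<and> (\<forall>x \<in> Ob C. iso_arr D (\<tau> x)))"

text \<open>\<open>R\<close> is right adjoint to \<open>L : C \<rightarrow> D\<close>: the bijections \<open>\<phi>\<close> are natural in both variables.\<close>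

definition right_adjoint ::
  "('o, 'm) cat \<Rightarrow> ('p, 'n) cat \<Rightarrow> ('o, 'm, 'p, 'n) fun_data \<Rightarrow> ('p, 'n, 'o, 'm) fun_data
    \<Rightarrow> bool" where
  "right_adjoint C D L R \<longleftrightarrow>
    (\<exists>\<phi>. (\<forall>x \<in> Ob C. \<forall>y \<in> Ob D.
            bij_betw (\<phi> x y) (homset D (ob_map L x) y) (homset C x (ob_map R y))) \<and>
         (\<forall>x \<in> Ob C. \<forall>x' \<in> Ob C. \<forall>y \<in> Ob D. \<forall>y' \<in> Ob D.
            \<forall>h \<in> homset C x' x. \<forall>g \<in> homset D y y'. \<forall>f \<in> homset D (ob_map L x) y.
              \<phi> x' y' (g \<cdot>\<^bsub>D\<^esub> f \<cdot>\<^bsub>D\<^esub> arr_map L h) = arr_map R g \<cdot>\<^bsub>C\<^esub> \<phi> x y f \<cdot>\<^bsub>C\<^esub> h))"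

definition full_subcategory :: "('o, 'm) cat \<Rightarrow> 'o set \<Rightarrow> ('o, 'm) cat" where
  "full_subcategory C S =
    C\<lparr>Ob := Ob C \<inter> S, Arr := {f \<in> Arr C. Dom C f \<in> S \<and> Cod C f \<in> S}\<rparr>"

definition equivalence_via ::
  "('o, 'm) cat \<Rightarrow> ('p, 'n) cat \<Rightarrow> ('o, 'm, 'p, 'n) fun_data \<Rightarrow> ('p, 'n, 'o, 'm) fun_data
    \<Rightarrow> bool" where
  "equivalence_via C D F G \<longleftrightarrow> is_functor C D F \<and> is_functor D C G \<and>
    nat_isomorphic C C (G \<circ>\<^sub>F F) id_fun \<and> nat_isomorphic D D (F \<circ>\<^sub>F G) id_fun"


section \<open>Closed objects\<close>

definition torsion_free :: "('o, 'm) cat \<Rightarrow> 'o set \<Rightarrow> 'o \<Rightarrow> bool" where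
  "torsion_free A S M \<longleftrightarrow>
    (\<forall>X \<in> S. \<forall>i \<in> homset A X M. mono_arr A i \<longrightarrow> zero_object A X)"

text \<open>\<open>p\<close> is the projection onto the quotient of \<open>X\<close> by the subobject \<open>i\<close>.\<close>

definition rel_injective :: "('o, 'm) cat \<Rightarrow> 'o set \<Rightarrow> 'o \<Rightarrow> bool" where
  "rel_injective A S M \<longleftrightarrow>
    (\<forall>X' \<in> Ob A. \<forall>X \<in> Ob A. \<forall>i \<in> homset A X' X. \<forall>p.
      mono_arr A i \<and> is_cokernel A p i \<and> Cod A p \<in> S \<longrightarrow>
      (\<forall>f \<in> homset A X' M. \<exists>g \<in> homset A X M. g \<cdot>\<^bsub>A\<^esub> i = f))"

definition closed_objects :: "('o, 'm) cat \<Rightarrow> 'o set \<Rightarrow> 'o set" where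
  "closed_objects A S = {M \<in> Ob A. torsion_free A S M \<and> rel_injective A S M}"


section \<open>Right wide Morita contexts\<close>

locale right_wide_Morita_context =
  A: abelian_category A + B: abelian_category B
  for A :: "('o, 'm) cat" and B :: "('p, 'n) cat" +
  fixes F :: "('p, 'n, 'o, 'm) fun_data" and G :: "('o, 'm, 'p, 'n) fun_data"
    and \<eta> :: "'o \<Rightarrow> 'm" and \<rho> :: "'p \<Rightarrow> 'n"
  assumes right_exact_F: "right_exact_functor B A F"
    and right_exact_G: "right_exact_functor A B G"
    and nat_eta: "nat_trans A A (F \<circ>\<^sub>F G) id_fun \<eta>"
    and nat_rho: "nat_trans B B (G \<circ>\<^sub>F F) id_fun \<rho>"
    and G_eta: "M \<in> Ob A \<Longrightarrow> arr_map G (\<eta> M) = \<rho> (ob_map G M)"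
    and F_rho: "N \<in> Ob B \<Longrightarrow> arr_map F (\<rho> N) = \<eta> (ob_map F N)"

text \<open>
  For a context with components \<open>\<eta>\<close> and \<open>\<rho>\<close>, the class \<open>C\<^sub>\<Gamma>\<close> is \<open>annihilated_class A \<eta>\<close> and
  \<open>D\<^sub>\<Gamma>\<close> is \<open>annihilated_class B \<rho>\<close>.
\<close>

definition annihilated_class :: "('o, 'm) cat \<Rightarrow> ('o \<Rightarrow> 'm) \<Rightarrow> 'o set" where
  "annihilated_class A \<eta> =
    {X \<in> Ob A. \<forall>M \<in> Ob A. \<forall>f \<in> homset A M X. f \<cdot>\<^bsub>A\<^esub> \<eta> M = Zero A (Dom A (\<eta> M)) X}"

end

theory Submission
  imports Defs
begin

text \<open>
  An object \<open>M\<close> is \<open>\<C>\<^sub>\<Gamma>\<close>-closed iff every \<open>FGN \<rightarrow> M\<close> factors uniquely through \<open>\<eta> N\<close>. Under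
  \<open>F \<stileturn> F'\<close> precomposition with \<open>F (\<rho> N) = \<eta> (F N)\<close> becomes precomposition with \<open>\<rho> N\<close>, so
  \<open>F'\<close> preserves this property. Under \<open>F \<stileturn> F'\<close> and \<open>G \<stileturn> G'\<close> precomposition with \<open>\<eta> N\<close> becomes
  postcomposition with the mate \<open>M \<rightarrow> G'F'M\<close> of \<open>\<eta>\<close>, which is therefore invertible for closed \<open>M\<close> by
  the Yoneda lemma. The hypotheses are symmetric in the two categories.
\<close>

section \<open>Preadditive and abelian categories\<close>

lemma homsetD:
  assumes "f \<in> homset C x y"
  shows "f \<in> Arr C" "Dom C f = x" "Cod C f = y"
  using assms by (auto simp: homset_def)

lemma (in category) Ob_of_homset:
  assumes "f \<in> homset C x y"
  shows "x \<in> Ob C" "y \<in> Ob C"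
  using assms Dom_in_Ob Cod_in_Ob by (auto simp: homset_def)

lemma mono_arr_cancel:
  assumes "mono_arr C m" "m \<in> homset C x y" "w \<in> Ob C" "f \<in> homset C w x" "g \<in> homset C w x"
    and "m \<cdot>\<^bsub>C\<^esub> f = m \<cdot>\<^bsub>C\<^esub> g"
  shows "f = g"
  using assms unfolding mono_arr_def by (auto simp: homsetD)

lemma epi_arr_cancel:
  assumes "epi_arr C e" "e \<in> homset C x y" "z \<in> Ob C" "f \<in> homset C y z" "g \<in> homset C y z"
    and "f \<cdot>\<^bsub>C\<^esub> e = g \<cdot>\<^bsub>C\<^esub> e"
  shows "f = g"
  using assms unfolding epi_arr_def by (auto simp: homsetD)

section \<open>Zero arrows, cancellation, monos and epis\<close>

context preadditive_category
begin

lemma Zero_in_homset: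
  assumes "x \<in> Ob C" "y \<in> Ob C"
  shows "Zero C x y \<in> homset C x y"
proof -
  interpret H: comm_group "hom_group C x y" using hom_comm_group assms by blast
  show ?thesis using H.one_closed by (simp add: hom_group_def)
qed

text \<open>Cancellation in the hom-group. Bilinearity makes composites with a zero arrow
  idempotent, additivity does the same for functor images of zero arrows, so one criterion settles
  both.\<close>

lemma idempotent_Sum_eq_Zero:
  assumes "f \<in> homset C x y" "Sum C f f = f"
  shows "f = Zero C x y"
proof -
  interpret H: comm_group "hom_group C x y" using hom_comm_group Ob_of_homset assms by blast
  show ?thesis using H.l_cancel_one[of f f] assms by (simp add: hom_group_def)
qed

lemma Sum_Zero:
  assumes "f \<in> homset C x y"
  shows "Sum C f (Zero C x y) = f"
proof -
  interpret H: comm_group "hom_group C x y" using hom_comm_group Ob_of_homset assms by blast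
  show ?thesis using H.r_one[of f] assms by (simp add: hom_group_def)
qed

lemma Comp_Zero:
  assumes "g \<in> homset C y z" "x \<in> Ob C"
  shows "g \<cdot> Zero C x y = Zero C x z"
proof -
  have z: "Zero C x y \<in> homset C x y" using Zero_in_homset assms Ob_of_homset by blast
  show ?thesis
    using Comp_Sum_right[OF z z assms(1)] Sum_Zero[OF z] Comp_in_homset[OF z assms(1)]
      idempotent_Sum_eq_Zero by metis
qed

lemma Zero_Comp:
  assumes "f \<in> homset C x y" "z \<in> Ob C"
  shows "Zero C y z \<cdot> f = Zero C x z"
proof -
  have z: "Zero C y z \<in> homset C y z" using Zero_in_homset assms Ob_of_homset by blast
  show ?thesis
    using Comp_Sum_left[OF assms(1) z z] Sum_Zero[OF z] Comp_in_homset[OF assms(1) z]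
      idempotent_Sum_eq_Zero by metis
qed

text \<open>The hypothesis is applied to the difference of \<open>f\<close> and \<open>g\<close>.
  Tests for epis and for injectivity of precomposition thereby reduce to zero arrows.\<close>

lemma cancel_right_if_reflects_Zero:
  assumes e: "e \<in> homset C w x" and f: "f \<in> homset C x y" and g: "g \<in> homset C x y"
    and zero: "\<And>d. d \<in> homset C x y \<Longrightarrow> d \<cdot> e = Zero C w y \<Longrightarrow> d = Zero C x y"
    and eq: "f \<cdot> e = g \<cdot> e"
  shows "f = g"
proof -
  interpret H: comm_group "hom_group C x y" using hom_comm_group Ob_of_homset f by blast
  interpret K: comm_group "hom_group C w y" using hom_comm_group Ob_of_homset e f by blast
  \<comment> \<open>The record \<open>cat\<close> has no negation, so the difference is formed with
    the inverse of \<open>hom_group\<close>.\<close>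
  define d where "d = inv\<^bsub>hom_group C x y\<^esub> g \<otimes>\<^bsub>hom_group C x y\<^esub> f"
  have d: "d \<in> homset C x y"
    using H.m_closed[OF H.inv_closed] f g by (simp add: d_def hom_group_def)
  have sum: "Sum C g d = f"
    using d f g d_def
    by (metis H.inv_closed H.inv_solve_left hom_group_def monoid.simps(1) partial_object.simps(1))
  have "Sum C (g \<cdot> e) (d \<cdot> e) = g \<cdot> e"
    using Comp_Sum_left[OF e g d] sum eq by simp
  then have "d \<cdot> e = Zero C w y"
    using K.r_cancel_one[of "g \<cdot> e" "d \<cdot> e"] K.l_cancel_one Comp_in_homset[OF e g] Comp_in_homset[OF e d]
    by (simp add: hom_group_def)
  then have "d = Zero C x y" by (rule zero[OF d])
  then show ?thesis using sum Sum_Zero[OF g] by simp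
qed

lemma epi_arrI:
  assumes e: "e \<in> homset C x y"
    and zero: "\<And>z u. z \<in> Ob C \<Longrightarrow> u \<in> homset C y z \<Longrightarrow> u \<cdot> e = Zero C x z \<Longrightarrow> u = Zero C y z"
  shows "epi_arr C e"
  unfolding epi_arr_def
  using cancel_right_if_reflects_Zero[OF e] zero e by (auto simp: homsetD)

text \<open>The identity and the zero endomorphism of \<open>x\<close> agree after composition with
  the mono, hence are equal. Every arrow into or out of \<open>x\<close> absorbs this identity and
  vanishes.\<close>

lemma mono_Zero_imp_zero_object:
  assumes mono: "mono_arr C (Zero C x y)" and x: "x \<in> Ob C" and y: "y \<in> Ob C"
  shows "zero_object C x"
proof -
  have z: "Zero C x y \<in> homset C x y" using Zero_in_homset x y .
  have id: "Id C x = Zero C x x"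
    using mono_arr_cancel[OF mono z x Id_in_homset Zero_in_homset] x Comp_Id[OF z] Comp_Zero[OF z x]
    by simp
  have "f = Zero C w x" if f: "f \<in> homset C w x" for w f
    using Id_Comp[OF f] Zero_Comp[OF f x] id by simp
  moreover have "f = Zero C x w" if f: "f \<in> homset C x w" for w f
    using Comp_Id[OF f] Comp_Zero[OF f x] id by simp
  ultimately show ?thesis
    unfolding zero_object_def using x Zero_in_homset by blast
qed

lemma Comp_through_zero_object:
  assumes "zero_object C x" and e: "e \<in> homset C w x" and m: "m \<in> homset C x y"
  shows "m \<cdot> e = Zero C w y"
proof -
  have w: "w \<in> Ob C" and x: "x \<in> Ob C" using Ob_of_homset e by auto
  then have "e = Zero C w x"
    using assms(1) e Zero_in_homset[OF w x] unfolding zero_object_def by blast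
  then show ?thesis using Comp_Zero[OF m w] by simp
qed

lemma is_kernel_mono:
  assumes k: "is_kernel C k f"
  shows "mono_arr C k"
proof -
  have f: "f \<in> homset C (Cod C k) (Cod C f)" and k': "k \<in> homset C (Dom C k) (Cod C k)"
    using k by (auto simp: is_kernel_def homset_def)
  have "g = h" if w: "w \<in> Ob C" and g: "g \<in> homset C w (Dom C k)" and h: "h \<in> homset C w (Dom C k)"
    and eq: "k \<cdot> g = k \<cdot> h" for w g h
  proof -
    have "f \<cdot> (k \<cdot> g) = (f \<cdot> k) \<cdot> g" using Comp_assoc[OF g k' f] by simp
    also have "\<dots> = Zero C w (Cod C f)"
      using k Zero_Comp[OF g] Ob_of_homset(2)[OF f] by (simp add: is_kernel_def)
    finally have "\<exists>!u. u \<in> homset C w (Dom C k) \<and> k \<cdot> u = k \<cdot> g"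
      using k w Comp_in_homset[OF g k'] by (simp add: is_kernel_def)
    then show ?thesis using g h eq by metis
  qed
  then show ?thesis using k by (simp add: mono_arr_def is_kernel_def)
qed

lemma is_cokernel_epi:
  assumes p: "is_cokernel C p f"
  shows "epi_arr C p"
proof -
  have f: "f \<in> homset C (Dom C f) (Dom C p)" and p': "p \<in> homset C (Dom C p) (Cod C p)"
    using p by (auto simp: is_cokernel_def homset_def)
  have "g = h" if z: "z \<in> Ob C" and g: "g \<in> homset C (Cod C p) z" and h: "h \<in> homset C (Cod C p) z"
    and eq: "g \<cdot> p = h \<cdot> p" for z g h
  proof -
    have "(g \<cdot> p) \<cdot> f = Zero C (Dom C f) z"
      using Comp_assoc[OF f p' g] Comp_Zero[OF g] Ob_of_homset(1)[OF f] p
      by (simp add: is_cokernel_def)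
    then have "\<exists>!u. u \<in> homset C (Cod C p) z \<and> u \<cdot> p = g \<cdot> p"
      using p z Comp_in_homset[OF p' g] by (simp add: is_cokernel_def)
    then show ?thesis using g h eq by metis
  qed
  then show ?thesis using p by (simp add: epi_arr_def is_cokernel_def)
qed

lemma mono_arr_Comp:
  assumes f: "f \<in> homset C x y" "mono_arr C f" and g: "g \<in> homset C y z" "mono_arr C g"
  shows "mono_arr C (g \<cdot> f)"
proof -
  have gf: "g \<cdot> f \<in> homset C x z" by (rule Comp_in_homset[OF f(1) g(1)])
  have "u = v" if w: "w \<in> Ob C" and u: "u \<in> homset C w x" and v: "v \<in> homset C w x"
    and eq: "(g \<cdot> f) \<cdot> u = (g \<cdot> f) \<cdot> v" for w u v
  proof -
    have "g \<cdot> (f \<cdot> u) = g \<cdot> (f \<cdot> v)"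
      using eq Comp_assoc[OF u f(1) g(1)] Comp_assoc[OF v f(1) g(1)] by simp
    then have "f \<cdot> u = f \<cdot> v"
      using mono_arr_cancel[OF g(2,1) w] Comp_in_homset f(1) u v by blast
    then show ?thesis using mono_arr_cancel[OF f(2,1) w u v] by simp
  qed
  then show ?thesis using gf by (auto simp: mono_arr_def homsetD)
qed

end

section \<open>Factorization through kernels, cokernels and images\<close>

lemma is_kernel_factor:
  assumes "is_kernel C k f" "f \<in> homset C x y" "w \<in> Ob C" "h \<in> homset C w x"
    and "f \<cdot>\<^bsub>C\<^esub> h = Zero C w y"
  obtains u where "u \<in> homset C w (Dom C k)" "k \<cdot>\<^bsub>C\<^esub> u = h"
proof -
  have "\<exists>!u. u \<in> homset C w (Dom C k) \<and> k \<cdot>\<^bsub>C\<^esub> u = h"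
    using assms homsetD[OF assms(2)] unfolding is_kernel_def by simp
  then show ?thesis using that by blast
qed

lemma is_cokernel_factor:
  assumes "is_cokernel C p f" "f \<in> homset C x y" "z \<in> Ob C" "h \<in> homset C y z"
    and "h \<cdot>\<^bsub>C\<^esub> f = Zero C x z"
  obtains u where "u \<in> homset C (Cod C p) z" "u \<cdot>\<^bsub>C\<^esub> p = h"
proof -
  have "\<exists>!u. u \<in> homset C (Cod C p) z \<and> u \<cdot>\<^bsub>C\<^esub> p = h"
    using assms homsetD[OF assms(2)] unfolding is_cokernel_def by simp
  then show ?thesis using that by blast
qed

lemma is_kernelD:
  assumes "is_kernel C k f" "f \<in> homset C x y"
  shows "k \<in> homset C (Dom C k) x" "f \<cdot>\<^bsub>C\<^esub> k = Zero C (Dom C k) y"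
  using assms by (auto simp: is_kernel_def homset_def)

lemma is_cokernelD:
  assumes "is_cokernel C p f" "f \<in> homset C x y"
  shows "p \<in> homset C y (Cod C p)" "p \<cdot>\<^bsub>C\<^esub> f = Zero C x (Cod C p)"
  using assms by (auto simp: is_cokernel_def homset_def)

text \<open>The mono is the image \<open>m\<close>, the kernel of the cokernel of \<open>f\<close>.
  The induced \<open>e\<close> is epi because the image is the smallest subobject through which
  \<open>f\<close> factors: if \<open>u\<close> kills \<open>e\<close>, then \<open>f\<close>
  already factors through the part of the image killed by \<open>u\<close>.\<close>

lemma (in abelian_category) epi_mono_factorization:
  assumes f: "f \<in> homset C x y"
  obtains i e m where "e \<in> homset C x i" "epi_arr C e" "m \<in> homset C i y" "mono_arr C m" "f = m \<cdot> e"
proof -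
  have x: "x \<in> Ob C" and y: "y \<in> Ob C" using Ob_of_homset f by auto
  obtain p where p: "is_cokernel C p f" using cokernel_exists homsetD(1)[OF f] by blast
  note pf = is_cokernelD[OF p f]
  obtain m where m: "is_kernel C m p" using kernel_exists homsetD(1)[OF pf(1)] by blast
  note pm = is_kernelD[OF m pf(1)]
  define i where "i = Dom C m"
  have mi: "m \<in> homset C i y" using pm by (simp add: i_def)
  have mm: "mono_arr C m" using m by (rule is_kernel_mono)
  obtain e where e: "e \<in> homset C x i" and me: "m \<cdot> e = f"
    using is_kernel_factor[OF m pf(1) x f pf(2)] by (auto simp: i_def)
  have "epi_arr C e"
  proof (rule epi_arrI[OF e])
    fix z u
    assume z: "z \<in> Ob C" and u: "u \<in> homset C i z" and ue: "u \<cdot> e = Zero C x z"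
    obtain n where n: "is_kernel C n u" using kernel_exists homsetD(1)[OF u] by blast
    define k where "k = Dom C n"
    have nk: "n \<in> homset C k i" and un: "u \<cdot> n = Zero C k z"
      using is_kernelD[OF n u] by (auto simp: k_def)
    obtain e' where e': "e' \<in> homset C x k" and ne: "n \<cdot> e' = e"
      using is_kernel_factor[OF n u x e ue] by (auto simp: k_def)
    have mn: "m \<cdot> n \<in> homset C k y" by (rule Comp_in_homset[OF nk mi])
    \<comment> \<open>The smaller subobject \<open>m \<cdot> n\<close> is again a kernel, say of
      \<open>g\<close>. This is what allows it to be compared with the image.\<close>
    have "mono_arr C (m \<cdot> n)"
      using mono_arr_Comp[OF nk is_kernel_mono[OF n] mi mm] .
    then obtain g where g: "is_kernel C (m \<cdot> n) g" using mono_is_kernel by blast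
    define z' where "z' = Cod C g"
    have gz: "g \<in> homset C y z'" and gmn: "g \<cdot> (m \<cdot> n) = Zero C k z'"
      using g mn by (auto simp: is_kernel_def homset_def z'_def)
    have z': "z' \<in> Ob C" using Ob_of_homset gz by blast
    \<comment> \<open>Since \<open>f\<close> factors through \<open>m \<cdot> n\<close>, it is
      killed by \<open>g\<close>, so \<open>g\<close> factors through the cokernel \<open>p\<close>
      of \<open>f\<close>.\<close>
    have "g \<cdot> f = g \<cdot> ((m \<cdot> n) \<cdot> e')" using Comp_assoc[OF e' nk mi] ne me by simp
    also have "\<dots> = (g \<cdot> (m \<cdot> n)) \<cdot> e'" using Comp_assoc[OF e' mn gz] by simp
    also have "\<dots> = Zero C x z'" using Zero_Comp[OF e' z'] gmn by simp
    finally obtain g' where g': "g' \<in> homset C (Cod C p) z'" and g'p: "g' \<cdot> p = g"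
      using is_cokernel_factor[OF p f z' gz] by blast
    have i: "i \<in> Ob C" using Ob_of_homset e by blast
    \<comment> \<open>Hence \<open>g\<close> kills \<open>m\<close> as well, and \<open>m\<close>
      factors back through \<open>m \<cdot> n\<close>. The resulting \<open>v\<close> is a right
      inverse of \<open>n\<close>, which forces \<open>u = 0\<close>.\<close>
    have "g \<cdot> m = g' \<cdot> (p \<cdot> m)" using Comp_assoc[OF mi pf(1) g'] g'p by simp
    also have "\<dots> = Zero C i z'" using Comp_Zero[OF g' i] pm(2) by (simp add: i_def)
    finally obtain v where v: "v \<in> homset C i k" and mnv: "(m \<cdot> n) \<cdot> v = m"
      using is_kernel_factor[OF g gz i mi] homsetD(2)[OF mn] by auto
    have "m \<cdot> (n \<cdot> v) = m \<cdot> Id C i"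
      using mnv Comp_assoc[OF v nk mi] Comp_Id[OF mi] by simp
    then have nv: "n \<cdot> v = Id C i"
      using mono_arr_cancel[OF mm mi i Comp_in_homset[OF v nk] Id_in_homset[OF i]] by blast
    have "u = (u \<cdot> n) \<cdot> v" using Comp_Id[OF u] Comp_assoc[OF v nk u] nv by simp
    then show "u = Zero C i z" using un Zero_Comp[OF v z] by simp
  qed
  then show ?thesis using that e mi mm me by blast
qed

section \<open>Functors and their composites\<close>

lemma is_functor_homset:
  assumes "is_functor C D F" "f \<in> homset C x y"
  shows "arr_map F f \<in> homset D (ob_map F x) (ob_map F y)"
  using assms by (auto simp: is_functor_def homset_def)

lemma is_functor_Comp:
  assumes "is_functor C D F" "f \<in> homset C x y" "g \<in> homset C y z"
  shows "arr_map F (g \<cdot>\<^bsub>C\<^esub> f) = arr_map F g \<cdot>\<^bsub>D\<^esub> arr_map F f"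
  using assms by (auto simp: is_functor_def homset_def)

lemma comp_fun_simps:
  "ob_map (G \<circ>\<^sub>F F) x = ob_map G (ob_map F x)"
  "arr_map (G \<circ>\<^sub>F F) f = arr_map G (arr_map F f)"
  by (simp_all add: comp_fun_def)

lemma is_functor_comp_fun:
  assumes "is_functor C D F" "is_functor D E G"
  shows "is_functor C E (G \<circ>\<^sub>F F)"
  using assms by (auto simp: is_functor_def comp_fun_simps homset_def)

lemma additive_functor_comp_fun:
  assumes F: "additive_functor C D F" and G: "additive_functor D E G"
  shows "additive_functor C E (G \<circ>\<^sub>F F)"
proof -
  have fF: "is_functor C D F" and fG: "is_functor D E G"
    using assms by (auto simp: additive_functor_def)
  have "arr_map G (arr_map F (Sum C f g)) = Sum E (arr_map G (arr_map F f)) (arr_map G (arr_map F g))"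
    if x: "x \<in> Ob C" and y: "y \<in> Ob C" and f: "f \<in> homset C x y" and g: "g \<in> homset C x y"
    for x y f g
  proof -
    have "ob_map F x \<in> Ob D" "ob_map F y \<in> Ob D" using fF x y by (auto simp: is_functor_def)
    moreover have "arr_map F (Sum C f g) = Sum D (arr_map F f) (arr_map F g)"
      using F x y f g unfolding additive_functor_def by blast
    ultimately show ?thesis
      using G is_functor_homset[OF fF f] is_functor_homset[OF fF g]
      unfolding additive_functor_def by simp
  qed
  then show ?thesis
    using is_functor_comp_fun[OF fF fG] unfolding additive_functor_def comp_fun_simps by blast
qed

lemma additive_functor_Zero:
  assumes "preadditive_category C" "preadditive_category D" and F: "additive_functor C D F"
    and x: "x \<in> Ob C" and y: "y \<in> Ob C"
  shows "arr_map F (Zero C x y) = Zero D (ob_map F x) (ob_map F y)"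
proof -
  interpret C: preadditive_category C by fact
  interpret D: preadditive_category D by fact
  have z: "Zero C x y \<in> homset C x y" using C.Zero_in_homset x y .
  show ?thesis
  proof (rule D.idempotent_Sum_eq_Zero)
    show "arr_map F (Zero C x y) \<in> homset D (ob_map F x) (ob_map F y)"
      using F by (intro is_functor_homset[OF _ z]) (simp add: additive_functor_def)
    show "Sum D (arr_map F (Zero C x y)) (arr_map F (Zero C x y)) = arr_map F (Zero C x y)"
      using F x y z C.Sum_Zero[OF z] unfolding additive_functor_def by metis
  qed
qed


section \<open>Closed objects of a well-copointed endofunctor\<close>

text \<open>Common abstraction of the composites \<open>FG\<close> and \<open>GF\<close>, so that
  closed objects are characterized once for both categories. Exactness enters only as preservation
  of epis.\<close>

locale well_copointed_endofunctor = abelian_category +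
  fixes E :: "('a, 'b, 'a, 'b) fun_data" and \<epsilon> :: "'a \<Rightarrow> 'b"
  assumes additive_E: "additive_functor C C E"
    and epi_E: "epi_arr C f \<Longrightarrow> epi_arr C (arr_map E f)"
    and nat_eps: "nat_trans C C E id_fun \<epsilon>"
    and E_eps: "M \<in> Ob C \<Longrightarrow> arr_map E (\<epsilon> M) = \<epsilon> (ob_map E M)"
begin

text \<open>Orthogonality to all components of \<open>\<epsilon>\<close>. Unlike closedness it
  speaks only of bijections between hom-sets, which adjunctions can transport.\<close>

definition local_object :: "'a \<Rightarrow> bool" where
  "local_object M \<longleftrightarrow> M \<in> Ob C \<and>
    (\<forall>N \<in> Ob C. bij_betw (\<lambda>f. f \<cdot> \<epsilon> N) (homset C N M) (homset C (ob_map E N) M))"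

lemma functor_E: "is_functor C C E"
  using additive_E by (simp add: additive_functor_def)

lemma E_Ob: "M \<in> Ob C \<Longrightarrow> ob_map E M \<in> Ob C"
  using functor_E by (simp add: is_functor_def)

lemma eps_in_homset: "M \<in> Ob C \<Longrightarrow> \<epsilon> M \<in> homset C (ob_map E M) M"
  using nat_eps by (simp add: nat_trans_def id_fun_def)

lemma eps_natural: "f \<in> homset C M N \<Longrightarrow> \<epsilon> N \<cdot> arr_map E f = f \<cdot> \<epsilon> M"
  using nat_eps by (auto simp: nat_trans_def id_fun_def homset_def)

text \<open>The identity of \<open>X\<close> is the universal test arrow: by naturality
  \<open>f \<cdot> \<epsilon> M\<close> factors through \<open>\<epsilon> X\<close>.\<close>

lemma annihilated_class_iff:
  "X \<in> annihilated_class C \<epsilon> \<longleftrightarrow> X \<in> Ob C \<and> \<epsilon> X = Zero C (ob_map E X) X"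
proof
  assume X: "X \<in> annihilated_class C \<epsilon>"
  then have Ob: "X \<in> Ob C" by (simp add: annihilated_class_def)
  then have "Id C X \<cdot> \<epsilon> X = Zero C (ob_map E X) X"
    using X Id_in_homset homsetD(2)[OF eps_in_homset] unfolding annihilated_class_def by fastforce
  then show "X \<in> Ob C \<and> \<epsilon> X = Zero C (ob_map E X) X"
    using Ob Id_Comp[OF eps_in_homset] by simp
next
  assume X: "X \<in> Ob C \<and> \<epsilon> X = Zero C (ob_map E X) X"
  have "f \<cdot> \<epsilon> M = Zero C (Dom C (\<epsilon> M)) X" if M: "M \<in> Ob C" and f: "f \<in> homset C M X" for M f
    using eps_natural[OF f] Zero_Comp[OF is_functor_homset[OF functor_E f]] X
      homsetD(2)[OF eps_in_homset[OF M]] by simp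
  then show "X \<in> annihilated_class C \<epsilon>" using X by (simp add: annihilated_class_def)
qed

text \<open>By naturality \<open>\<epsilon> I\<close> composed with the epi \<open>E e\<close>
  equals \<open>e \<cdot> \<epsilon> N = 0\<close>, so \<open>\<epsilon> I\<close> is zero.\<close>

lemma epi_annihilates_imp_annihilated:
  assumes e: "e \<in> homset C N I" "epi_arr C e" and zero: "e \<cdot> \<epsilon> N = Zero C (ob_map E N) I"
  shows "I \<in> annihilated_class C \<epsilon>"
proof -
  have I: "I \<in> Ob C" and N: "N \<in> Ob C" using Ob_of_homset e by auto
  have Ee: "arr_map E e \<in> homset C (ob_map E N) (ob_map E I)"
    by (rule is_functor_homset[OF functor_E e(1)])
  have "\<epsilon> I \<cdot> arr_map E e = Zero C (ob_map E I) I \<cdot> arr_map E e"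
    using eps_natural[OF e(1)] zero Zero_Comp[OF Ee I] by simp
  then have "\<epsilon> I = Zero C (ob_map E I) I"
    using epi_arr_cancel[OF epi_E[OF e(2)] Ee I eps_in_homset[OF I] Zero_in_homset[OF E_Ob[OF I] I]]
    by simp
  then show ?thesis using I annihilated_class_iff by blast
qed

text \<open>The image of \<open>f\<close> is a quotient of \<open>N\<close> on which
  \<open>\<epsilon> N\<close> dies, so it lies in the class. It is also a subobject of the torsion
  free \<open>M\<close>, hence zero.\<close>

lemma torsion_free_annihilates_imp_Zero:
  assumes tf: "torsion_free C (annihilated_class C \<epsilon>) M" and f: "f \<in> homset C N M"
    and zero: "f \<cdot> \<epsilon> N = Zero C (ob_map E N) M"
  shows "f = Zero C N M"
proof -
  obtain I e m where e: "e \<in> homset C N I" "epi_arr C e" and m: "m \<in> homset C I M" "mono_arr C m"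
    and fme: "f = m \<cdot> e"
    using epi_mono_factorization[OF f] by blast
  have N: "N \<in> Ob C" and I: "I \<in> Ob C" using Ob_of_homset e by auto
  note EN = E_Ob[OF N] and epsN = eps_in_homset[OF N]
  have "m \<cdot> (e \<cdot> \<epsilon> N) = m \<cdot> Zero C (ob_map E N) I"
    using Comp_assoc[OF epsN e(1) m(1)] fme zero Comp_Zero[OF m(1) EN] by simp
  then have "e \<cdot> \<epsilon> N = Zero C (ob_map E N) I"
    using mono_arr_cancel[OF m(2,1) EN Comp_in_homset[OF epsN e(1)] Zero_in_homset[OF EN I]] by simp
  then have "I \<in> annihilated_class C \<epsilon>" by (rule epi_annihilates_imp_annihilated[OF e])
  then have "zero_object C I" using tf m unfolding torsion_free_def by blast
  then show ?thesis using Comp_through_zero_object[OF _ e(1) m(1)] fme by simp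
qed

text \<open>
  \<open>h : E N \<rightarrow> M\<close> factors through the image of \<open>\<epsilon> N\<close>, because for \<open>\<epsilon> N \<cdot> g = 0\<close> the arrow \<open>h \<cdot> g\<close> is
  annihilated: \<open>g \<cdot> \<epsilon> W = \<epsilon> (E N) \<cdot> E g = E (\<epsilon> N \<cdot> g) = 0\<close>. It extends from there to \<open>N\<close>, as the
  cokernel of \<open>\<epsilon> N\<close> is in the class.
\<close>

lemma closed_imp_local:
  assumes M: "M \<in> closed_objects C (annihilated_class C \<epsilon>)"
  shows "local_object M"
proof -
  have MO: "M \<in> Ob C" and tf: "torsion_free C (annihilated_class C \<epsilon>) M"
    and inj: "rel_injective C (annihilated_class C \<epsilon>) M"
    using M by (auto simp: closed_objects_def)
  have "bij_betw (\<lambda>f. f \<cdot> \<epsilon> N) (homset C N M) (homset C (ob_map E N) M)" if N: "N \<in> Ob C" for N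
  proof (rule bij_betw_imageI)
    note EN = E_Ob[OF N] and epsN = eps_in_homset[OF N]
    \<comment> \<open>The difference of two arrows with equal composites is killed by
      \<open>\<epsilon> N\<close>, hence zero by torsion freeness.\<close>
    show "inj_on (\<lambda>f. f \<cdot> \<epsilon> N) (homset C N M)"
      using cancel_right_if_reflects_Zero[OF epsN] torsion_free_annihilates_imp_Zero[OF tf]
      by (auto intro!: inj_onI)
    show "(\<lambda>f. f \<cdot> \<epsilon> N) ` homset C N M = homset C (ob_map E N) M"
    proof
      show "(\<lambda>f. f \<cdot> \<epsilon> N) ` homset C N M \<subseteq> homset C (ob_map E N) M"
        using Comp_in_homset[OF epsN] by auto
      show "homset C (ob_map E N) M \<subseteq> (\<lambda>f. f \<cdot> \<epsilon> N) ` homset C N M"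
      proof
        fix h assume h: "h \<in> homset C (ob_map E N) M"
        obtain I e i where e: "e \<in> homset C (ob_map E N) I" "epi_arr C e"
          and i: "i \<in> homset C I N" "mono_arr C i" and eps: "\<epsilon> N = i \<cdot> e"
          using epi_mono_factorization[OF epsN] by blast
        have I: "I \<in> Ob C" using Ob_of_homset i by blast
        \<comment> \<open>The epi \<open>e\<close> is the cokernel of some \<open>g\<close>, so
          \<open>h\<close> descends along \<open>e\<close> as soon as
          \<open>h \<cdot> g = 0\<close>.\<close>
        obtain g where eg: "is_cokernel C e g" using epi_is_cokernel e by blast
        define W where "W = Dom C g"
        have g: "g \<in> homset C W (ob_map E N)"
          using eg homsetD(2)[OF e(1)] by (auto simp: is_cokernel_def homset_def W_def)
        have W: "W \<in> Ob C" using Ob_of_homset g by blast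
        note EW = E_Ob[OF W] and epsW = eps_in_homset[OF W] and Eg = is_functor_homset[OF functor_E g]
        have eg0: "e \<cdot> g = Zero C W I" using is_cokernelD(2)[OF eg g] homsetD(3)[OF e(1)] by simp
        have eps_g: "\<epsilon> N \<cdot> g = Zero C W N"
          using eps Comp_assoc[OF g e(1) i(1)] eg0 Comp_Zero[OF i(1) W] by simp
        have "\<epsilon> (ob_map E N) \<cdot> arr_map E g = Zero C (ob_map E W) (ob_map E N)"
          using is_functor_Comp[OF functor_E g epsN] E_eps[OF N] eps_g
            additive_functor_Zero[OF preadditive_category_axioms preadditive_category_axioms
              additive_E W N] by simp
        then have "g \<cdot> \<epsilon> W = Zero C (ob_map E W) (ob_map E N)" using eps_natural[OF g] by simp
        then have "(h \<cdot> g) \<cdot> \<epsilon> W = Zero C (ob_map E W) M"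
          using Comp_assoc[OF epsW g h] Comp_Zero[OF h EW] by simp
        then have "h \<cdot> g = Zero C W M"
          by (rule torsion_free_annihilates_imp_Zero[OF tf Comp_in_homset[OF g h]])
        then obtain h' where h': "h' \<in> homset C I M" and h'e: "h' \<cdot> e = h"
          using is_cokernel_factor[OF eg g MO h] homsetD(3)[OF e(1)] by auto
        obtain p where p: "is_cokernel C p i" using cokernel_exists homsetD(1)[OF i(1)] by blast
        note pi = is_cokernelD[OF p i(1)]
        have P: "Cod C p \<in> Ob C" using Ob_of_homset pi by blast
        have "p \<cdot> \<epsilon> N = Zero C (ob_map E N) (Cod C p)"
          using eps Comp_assoc[OF e(1) i(1) pi(1)] pi(2) Zero_Comp[OF e(1) P] by simp
        then have "Cod C p \<in> annihilated_class C \<epsilon>"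
          by (rule epi_annihilates_imp_annihilated[OF pi(1) is_cokernel_epi[OF p]])
        then obtain k where k: "k \<in> homset C N M" and ki: "k \<cdot> i = h'"
          using inj I N i p h' unfolding rel_injective_def by blast
        have "k \<cdot> \<epsilon> N = h" using eps Comp_assoc[OF e(1) i(1) k] ki h'e by simp
        then show "h \<in> (\<lambda>f. f \<cdot> \<epsilon> N) ` homset C N M" using k by blast
      qed
    qed
  qed
  then show ?thesis using MO by (simp add: local_object_def)
qed

section \<open>From local objects back to closed objects\<close>

lemma local_object_cancel:
  assumes "local_object M" "f \<in> homset C N M" "g \<in> homset C N M" "f \<cdot> \<epsilon> N = g \<cdot> \<epsilon> N"
  shows "f = g"
  using assms Ob_of_homset unfolding local_object_def bij_betw_def inj_on_def by blast

lemma local_object_factor: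
  assumes "local_object M" "N \<in> Ob C" "h \<in> homset C (ob_map E N) M"
  obtains f where "f \<in> homset C N M" "f \<cdot> \<epsilon> N = h"
proof -
  have "h \<in> (\<lambda>f. f \<cdot> \<epsilon> N) ` homset C N M"
    using assms by (simp add: local_object_def bij_betw_def)
  then show ?thesis using that by blast
qed

text \<open>
  For a subobject \<open>i\<close> with quotient in the class, \<open>\<epsilon> X\<close> factors as \<open>i \<cdot> t\<close>, and the extension of \<open>f\<close>
  along \<open>i\<close> is the arrow \<open>g\<close> with \<open>g \<cdot> \<epsilon> X = f \<cdot> t\<close>.
\<close>

lemma local_imp_closed:
  assumes M: "local_object M"
  shows "M \<in> closed_objects C (annihilated_class C \<epsilon>)"
proof -
  have MO: "M \<in> Ob C" using M by (simp add: local_object_def)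
  have "torsion_free C (annihilated_class C \<epsilon>) M"
    unfolding torsion_free_def
  proof (intro ballI impI)
    fix X i
    assume "X \<in> annihilated_class C \<epsilon>" and i: "i \<in> homset C X M" "mono_arr C i"
    then have X: "X \<in> Ob C" and eps: "\<epsilon> X = Zero C (ob_map E X) X"
      using annihilated_class_iff by auto
    \<comment> \<open>After composition with \<open>\<epsilon> X = 0\<close> the mono
      \<open>i\<close> agrees with the zero arrow, so locality identifies the two.\<close>
    have "i \<cdot> \<epsilon> X = Zero C X M \<cdot> \<epsilon> X"
      using eps Comp_Zero[OF i(1) E_Ob[OF X]] Zero_Comp[OF eps_in_homset[OF X] MO] by simp
    then have "i = Zero C X M"
      by (rule local_object_cancel[OF M i(1) Zero_in_homset[OF X MO]])
    then show "zero_object C X" using mono_Zero_imp_zero_object i X MO by blast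
  qed
  moreover have "rel_injective C (annihilated_class C \<epsilon>) M"
    unfolding rel_injective_def
  proof (intro ballI allI impI)
    fix X' X i p f
    assume X': "X' \<in> Ob C" and X: "X \<in> Ob C" and i: "i \<in> homset C X' X"
      and ip: "mono_arr C i \<and> is_cokernel C p i \<and> Cod C p \<in> annihilated_class C \<epsilon>"
      and f: "f \<in> homset C X' M"
    define Z where "Z = Cod C p"
    have mono: "mono_arr C i" and pi: "p \<in> homset C X Z" "p \<cdot> i = Zero C X' Z"
      and Z: "Z \<in> Ob C" "\<epsilon> Z = Zero C (ob_map E Z) Z"
      using ip is_cokernelD[OF _ i] annihilated_class_iff by (auto simp: Z_def)
    note EX = E_Ob[OF X] and epsX = eps_in_homset[OF X] and EX' = E_Ob[OF X']
      and epsX' = eps_in_homset[OF X'] and Ei = is_functor_homset[OF functor_E i]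
    have p_eps: "p \<cdot> \<epsilon> X = Zero C (ob_map E X) Z"
      using eps_natural[OF pi(1)] Z Zero_Comp[OF is_functor_homset[OF functor_E pi(1)]] by simp
    \<comment> \<open>The mono \<open>i\<close> is known as a kernel of some \<open>q\<close>, not
      of its cokernel \<open>p\<close>. As \<open>q\<close> factors through \<open>p\<close>, it too
      kills \<open>\<epsilon> X\<close>, which gives the lift \<open>t\<close>.\<close>
    obtain q where q: "is_kernel C i q" using mono_is_kernel mono by blast
    define Y where "Y = Cod C q"
    have qY: "q \<in> homset C X Y" "q \<cdot> i = Zero C X' Y"
      using q i by (auto simp: is_kernel_def homset_def Y_def)
    have Y: "Y \<in> Ob C" using Ob_of_homset qY by blast
    obtain r where r: "r \<in> homset C Z Y" and rp: "r \<cdot> p = q"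
      using is_cokernel_factor[of C p i, OF _ i Y qY] ip by (auto simp: Z_def)
    have "q \<cdot> \<epsilon> X = Zero C (ob_map E X) Y"
      using rp Comp_assoc[OF epsX pi(1) r] p_eps Comp_Zero[OF r EX] by simp
    then obtain t where t: "t \<in> homset C (ob_map E X) X'" and it: "i \<cdot> t = \<epsilon> X"
      using is_kernel_factor[OF q qY(1) EX epsX] homsetD(2)[OF i] by auto
    \<comment> \<open>Cancelling \<open>i\<close> shows that \<open>t\<close> extends
      \<open>\<epsilon> X'\<close> along \<open>E i\<close>; this makes \<open>g \<cdot> i\<close>
      and \<open>f\<close> agree after \<open>\<epsilon> X'\<close>.\<close>
    have "i \<cdot> (t \<cdot> arr_map E i) = i \<cdot> \<epsilon> X'"
      using Comp_assoc[OF Ei t i] it eps_natural[OF i] by simp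
    then have tEi: "t \<cdot> arr_map E i = \<epsilon> X'"
      by (rule mono_arr_cancel[OF mono i EX' Comp_in_homset[OF Ei t] epsX'])
    obtain g where g: "g \<in> homset C X M" and g_eps: "g \<cdot> \<epsilon> X = f \<cdot> t"
      using local_object_factor[OF M X Comp_in_homset[OF t f]] by blast
    have "(g \<cdot> i) \<cdot> \<epsilon> X' = (g \<cdot> \<epsilon> X) \<cdot> arr_map E i"
      using Comp_assoc[OF epsX' i g] Comp_assoc[OF Ei epsX g] eps_natural[OF i] by simp
    also have "\<dots> = f \<cdot> \<epsilon> X'" using g_eps Comp_assoc[OF Ei t f] tEi by simp
    finally have "g \<cdot> i = f" by (rule local_object_cancel[OF M Comp_in_homset[OF i g] f])
    then show "\<exists>g \<in> homset C X M. g \<cdot> i = f" using g by blast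
  qed
  ultimately show ?thesis using MO by (simp add: closed_objects_def)
qed

lemma closed_iff_local: "M \<in> closed_objects C (annihilated_class C \<epsilon>) \<longleftrightarrow> local_object M"
  using closed_imp_local local_imp_closed by blast

end


section \<open>Adjunctions\<close>

text \<open>The bijections \<open>\<phi>\<close> are a parameter, whereas
  \<open>right_adjoint\<close> only asserts that they exist: the mate of \<open>\<eta>\<close> is
  built from them.\<close>

locale adjunction = C: category C + D: category D
  for C :: "('o, 'm) cat" and D :: "('p, 'n) cat" +
  fixes L :: "('o, 'm, 'p, 'n) fun_data" and R :: "('p, 'n, 'o, 'm) fun_data"
    and \<phi> :: "'o \<Rightarrow> 'p \<Rightarrow> 'n \<Rightarrow> 'm"
  assumes functor_L: "is_functor C D L" and functor_R: "is_functor D C R"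
    and bij_phi: "\<lbrakk>x \<in> Ob C; y \<in> Ob D\<rbrakk>
      \<Longrightarrow> bij_betw (\<phi> x y) (homset D (ob_map L x) y) (homset C x (ob_map R y))"
    and phi_natural: "\<lbrakk>h \<in> homset C x' x; g \<in> homset D y y'; f \<in> homset D (ob_map L x) y\<rbrakk>
      \<Longrightarrow> \<phi> x' y' (g \<cdot>\<^bsub>D\<^esub> f \<cdot>\<^bsub>D\<^esub> arr_map L h) = arr_map R g \<cdot>\<^bsub>C\<^esub> \<phi> x y f \<cdot>\<^bsub>C\<^esub> h"
begin

lemma L_Ob: "x \<in> Ob C \<Longrightarrow> ob_map L x \<in> Ob D"
  using functor_L by (simp add: is_functor_def)

lemma R_Ob: "y \<in> Ob D \<Longrightarrow> ob_map R y \<in> Ob C"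
  using functor_R by (simp add: is_functor_def)

lemma phi_in_homset:
  assumes "x \<in> Ob C" "f \<in> homset D (ob_map L x) y"
  shows "\<phi> x y f \<in> homset C x (ob_map R y)"
  using assms bij_phi D.Ob_of_homset bij_betwE by metis

lemma phi_left:
  assumes h: "h \<in> homset C x' x" and f: "f \<in> homset D (ob_map L x) y"
  shows "\<phi> x' y (f \<cdot>\<^bsub>D\<^esub> arr_map L h) = \<phi> x y f \<cdot>\<^bsub>C\<^esub> h"
proof -
  have x: "x \<in> Ob C" and y: "y \<in> Ob D" using h f C.Ob_of_homset D.Ob_of_homset by auto
  have "f \<cdot>\<^bsub>D\<^esub> arr_map L h \<in> homset D (ob_map L x') y"
    using D.Comp_in_homset is_functor_homset[OF functor_L h] f by blast
  moreover have "\<phi> x y f \<cdot>\<^bsub>C\<^esub> h \<in> homset C x' (ob_map R y)"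
    using C.Comp_in_homset phi_in_homset[OF x f] h by blast
  moreover have "arr_map R (Id D y) = Id C (ob_map R y)"
    using functor_R y by (simp add: is_functor_def)
  ultimately show ?thesis
    using phi_natural[OF h D.Id_in_homset[OF y] f] D.Id_Comp C.Id_Comp by metis
qed

lemma phi_right:
  assumes x: "x \<in> Ob C" and g: "g \<in> homset D y y'" and f: "f \<in> homset D (ob_map L x) y"
  shows "\<phi> x y' (g \<cdot>\<^bsub>D\<^esub> f) = arr_map R g \<cdot>\<^bsub>C\<^esub> \<phi> x y f"
proof -
  have "arr_map L (Id C x) = Id D (ob_map L x)"
    using functor_L x by (simp add: is_functor_def)
  then show ?thesis
    using phi_natural[OF C.Id_in_homset[OF x] g f] D.Comp_Id[OF f] C.Comp_Id[OF phi_in_homset[OF x f]]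
    by simp
qed

text \<open>\<open>\<phi>\<close> turns precomposition with \<open>L e\<close> into precomposition
  with \<open>e\<close>, where it can be cancelled. This provides \<open>epi_E\<close> for both
  composites.\<close>

lemma epi_L:
  assumes "epi_arr C e"
  shows "epi_arr D (arr_map L e)"
proof -
  define x y where "x = Dom C e" and "y = Cod C e"
  have e: "e \<in> homset C x y" using assms by (auto simp: epi_arr_def homset_def x_def y_def)
  have y: "y \<in> Ob C" using C.Ob_of_homset e by blast
  have Le: "arr_map L e \<in> homset D (ob_map L x) (ob_map L y)"
    using is_functor_homset[OF functor_L e] .
  have "g = h" if z: "z \<in> Ob D" and g: "g \<in> homset D (ob_map L y) z"
    and h: "h \<in> homset D (ob_map L y) z" and eq: "g \<cdot>\<^bsub>D\<^esub> arr_map L e = h \<cdot>\<^bsub>D\<^esub> arr_map L e" for z g h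
  proof -
    have "\<phi> y z g \<cdot>\<^bsub>C\<^esub> e = \<phi> y z h \<cdot>\<^bsub>C\<^esub> e"
      using eq phi_left[OF e g] phi_left[OF e h] by simp
    then have "\<phi> y z g = \<phi> y z h"
      using epi_arr_cancel[OF assms e R_Ob[OF z] phi_in_homset[OF y g] phi_in_homset[OF y h]] by simp
    then show ?thesis
      using bij_phi[OF y z] g h by (auto simp: bij_betw_def inj_on_def)
  qed
  then show ?thesis using Le by (auto simp: epi_arr_def homsetD)
qed

end

text \<open>The Yoneda argument: surjectivity at \<open>y\<close> gives a right inverse of
  \<open>f\<close>, and injectivity at \<open>x\<close> makes it a left inverse.\<close>

lemma (in category) iso_arrI_bij_postcomposition:
  assumes f: "f \<in> homset C x y"
    and bij: "\<And>w. w \<in> Ob C \<Longrightarrow> bij_betw (\<lambda>g. f \<cdot> g) (homset C w x) (homset C w y)"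
  shows "iso_arr C f"
proof -
  have x: "x \<in> Ob C" and y: "y \<in> Ob C" using Ob_of_homset f by auto
  obtain g where g: "g \<in> homset C y x" and fg: "f \<cdot> g = Id C y"
    using bij[OF y] Id_in_homset[OF y] unfolding bij_betw_def by (metis imageE)
  have "f \<cdot> (g \<cdot> f) = f \<cdot> Id C x"
    using Comp_assoc[OF f g f] fg Id_Comp[OF f] Comp_Id[OF f] by simp
  then have "g \<cdot> f = Id C x"
    using bij[OF x] Comp_in_homset[OF f g] Id_in_homset[OF x] unfolding bij_betw_def inj_on_def by blast
  then show ?thesis using f g fg by (auto simp: iso_arr_def homsetD)
qed

section \<open>Restriction to full subcategories\<close>

lemma homset_full_subcategory:
  assumes "x \<in> S" "y \<in> S"
  shows "homset (full_subcategory C S) x y = homset C x y"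
  using assms by (auto simp: homset_def full_subcategory_def)

lemma full_subcategory_simps:
  "Ob (full_subcategory C S) = Ob C \<inter> S"
  "Arr (full_subcategory C S) = {f \<in> Arr C. Dom C f \<in> S \<and> Cod C f \<in> S}"
  "Dom (full_subcategory C S) = Dom C"
  "Cod (full_subcategory C S) = Cod C"
  "Id (full_subcategory C S) = Id C"
  "Comp (full_subcategory C S) = Comp C"
  by (simp_all add: full_subcategory_def)

lemma is_functor_full_subcategory:
  assumes "is_functor C D F" and "\<And>x. x \<in> Ob C \<Longrightarrow> x \<in> S \<Longrightarrow> ob_map F x \<in> T"
    and "category C"
  shows "is_functor (full_subcategory C S) (full_subcategory D T) F"
  using assms category.Dom_in_Ob[of C] category.Cod_in_Ob[of C]
  unfolding is_functor_def by (auto simp: full_subcategory_simps homset_def)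

text \<open>The mate points from the identity to \<open>H\<close>, the opposite of what
  \<open>nat_isomorphic\<close> with \<open>id_fun\<close> second requires, and need be invertible
  only on \<open>S\<close>. The isomorphism is therefore assembled from chosen inverses
  \<open>\<sigma>\<close>.\<close>

lemma (in category) nat_isomorphic_full_subcategoryI:
  assumes H: "is_functor C C H"
    and \<tau>: "\<And>x. x \<in> Ob C \<Longrightarrow> \<tau> x \<in> homset C x (ob_map H x)"
    and nat: "\<And>x y f. f \<in> homset C x y \<Longrightarrow> \<tau> y \<cdot> f = arr_map H f \<cdot> \<tau> x"
    and iso: "\<And>x. x \<in> Ob C \<Longrightarrow> x \<in> S \<Longrightarrow> iso_arr C (\<tau> x)"
    and HS: "\<And>x. x \<in> Ob C \<Longrightarrow> x \<in> S \<Longrightarrow> ob_map H x \<in> S"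
  shows "nat_isomorphic (full_subcategory C S) (full_subcategory C S) H id_fun"
proof -
  have "\<exists>g. g \<in> homset C (ob_map H x) x \<and> g \<cdot> \<tau> x = Id C x \<and> \<tau> x \<cdot> g = Id C (ob_map H x)"
    if "x \<in> Ob C \<inter> S" for x
    using iso[of x] homsetD[OF \<tau>[of x]] that by (auto simp: iso_arr_def)
  then obtain \<sigma> where \<sigma>: "\<And>x. x \<in> Ob C \<inter> S \<Longrightarrow> \<sigma> x \<in> homset C (ob_map H x) x"
    and \<sigma>\<tau>: "\<And>x. x \<in> Ob C \<inter> S \<Longrightarrow> \<sigma> x \<cdot> \<tau> x = Id C x"
    and \<tau>\<sigma>: "\<And>x. x \<in> Ob C \<inter> S \<Longrightarrow> \<tau> x \<cdot> \<sigma> x = Id C (ob_map H x)"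
    by metis
  have natural: "\<sigma> y \<cdot> arr_map H f = f \<cdot> \<sigma> x" if f: "f \<in> homset C x y" and S: "x \<in> S" "y \<in> S" for x y f
  proof -
    have x: "x \<in> Ob C \<inter> S" and y: "y \<in> Ob C \<inter> S" using Ob_of_homset[OF f] S by auto
    note Hf = is_functor_homset[OF H f] and sx = \<sigma>[OF x] and sy = \<sigma>[OF y]
    have tx: "\<tau> x \<in> homset C x (ob_map H x)" and ty: "\<tau> y \<in> homset C y (ob_map H y)"
      using \<tau> x y by auto
    \<comment> \<open>Insert \<open>\<tau> x \<cdot> \<sigma> x\<close>, move \<open>\<tau>\<close>
      across by naturality, and cancel \<open>\<sigma> y \<cdot> \<tau> y\<close>.\<close>
    have "\<sigma> y \<cdot> arr_map H f = \<sigma> y \<cdot> (arr_map H f \<cdot> (\<tau> x \<cdot> \<sigma> x))"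
      using \<tau>\<sigma>[OF x] Comp_Id[OF Hf] by simp
    also have "\<dots> = \<sigma> y \<cdot> ((\<tau> y \<cdot> f) \<cdot> \<sigma> x)"
      using Comp_assoc[OF sx tx Hf] nat[OF f] by simp
    also have "\<dots> = (\<sigma> y \<cdot> (\<tau> y \<cdot> f)) \<cdot> \<sigma> x"
      using Comp_assoc[OF sx Comp_in_homset[OF f ty] sy] by simp
    also have "\<dots> = f \<cdot> \<sigma> x"
      using Comp_assoc[OF f ty sy] \<sigma>\<tau>[OF y] Id_Comp[OF f] by simp
    finally show ?thesis .
  qed
  have "nat_trans (full_subcategory C S) (full_subcategory C S) H id_fun \<sigma>"
    unfolding nat_trans_def
  proof (intro conjI ballI)
    fix x assume "x \<in> Ob (full_subcategory C S)"
    then show "\<sigma> x \<in> homset (full_subcategory C S) (ob_map H x) (ob_map id_fun x)"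
      using \<sigma>[of x] HS by (simp add: full_subcategory_simps homset_full_subcategory id_fun_def)
  next
    fix f assume "f \<in> Arr (full_subcategory C S)"
    then show "\<sigma> (Cod (full_subcategory C S) f) \<cdot>\<^bsub>full_subcategory C S\<^esub> arr_map H f
        = arr_map id_fun f \<cdot>\<^bsub>full_subcategory C S\<^esub> \<sigma> (Dom (full_subcategory C S) f)"
      using natural[of f "Dom C f" "Cod C f"]
      by (simp add: full_subcategory_simps homset_def id_fun_def)
  qed
  moreover have "iso_arr (full_subcategory C S) (\<sigma> x)" if "x \<in> Ob (full_subcategory C S)" for x
  proof -
    have x: "x \<in> Ob C \<inter> S" using that by (simp add: full_subcategory_simps)
    have "ob_map H x \<in> S" and "\<tau> x \<in> homset C x (ob_map H x)" using HS \<tau> x by auto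
    then show ?thesis
      using x \<sigma>[OF x] \<sigma>\<tau>[OF x] \<tau>\<sigma>[OF x] unfolding iso_arr_def
      by (auto simp: full_subcategory_simps homset_def intro!: bexI[of _ "\<tau> x"])
  qed
  ultimately show ?thesis unfolding nat_isomorphic_def by blast
qed


section \<open>Morita contexts with right adjoints\<close>

locale adjoint_Morita_context =
  right_wide_Morita_context A B F G \<eta> \<rho> + F: adjunction B A F F' \<phi> + G: adjunction A B G G' \<psi>
  for A :: "('o, 'm) cat" and B :: "('p, 'n) cat"
    and F :: "('p, 'n, 'o, 'm) fun_data" and G :: "('o, 'm, 'p, 'n) fun_data"
    and \<eta> :: "'o \<Rightarrow> 'm" and \<rho> :: "'p \<Rightarrow> 'n"
    and F' :: "('o, 'm, 'p, 'n) fun_data" and G' :: "('p, 'n, 'o, 'm) fun_data"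
    and \<phi> :: "'p \<Rightarrow> 'o \<Rightarrow> 'm \<Rightarrow> 'n" and \<psi> :: "'o \<Rightarrow> 'p \<Rightarrow> 'n \<Rightarrow> 'm"
begin

lemma additive_F: "additive_functor B A F" and additive_G: "additive_functor A B G"
  using right_exact_F right_exact_G by (auto simp: right_exact_functor_def)

text \<open>The two context equations combine to \<open>FG\<eta> = F\<rho>G = \<eta>FG\<close>. Epis
  are preserved because \<open>F\<close> and \<open>G\<close> are left adjoints.\<close>

sublocale FG: well_copointed_endofunctor A "F \<circ>\<^sub>F G" \<eta>
proof
  show "additive_functor A A (F \<circ>\<^sub>F G)"
    using additive_functor_comp_fun[OF additive_G additive_F] .
  show "epi_arr A (arr_map (F \<circ>\<^sub>F G) f)" if "epi_arr A f" for f
    using F.epi_L G.epi_L that by (simp add: comp_fun_simps)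
  show "nat_trans A A (F \<circ>\<^sub>F G) id_fun \<eta>" by (rule nat_eta)
  show "arr_map (F \<circ>\<^sub>F G) (\<eta> M) = \<eta> (ob_map (F \<circ>\<^sub>F G) M)" if "M \<in> Ob A" for M
    using that G_eta F_rho G.L_Ob by (simp add: comp_fun_simps)
qed

sublocale GF: well_copointed_endofunctor B "G \<circ>\<^sub>F F" \<rho>
proof
  show "additive_functor B B (G \<circ>\<^sub>F F)"
    using additive_functor_comp_fun[OF additive_F additive_G] .
  show "epi_arr B (arr_map (G \<circ>\<^sub>F F) f)" if "epi_arr B f" for f
    using F.epi_L G.epi_L that by (simp add: comp_fun_simps)
  show "nat_trans B B (G \<circ>\<^sub>F F) id_fun \<rho>" by (rule nat_rho)
  show "arr_map (G \<circ>\<^sub>F F) (\<rho> N) = \<rho> (ob_map (G \<circ>\<^sub>F F) N)" if "N \<in> Ob B" for N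
    using that G_eta F_rho F.L_Ob by (simp add: comp_fun_simps)
qed

section \<open>Transport of local objects and the mate of the counit-like transformation\<close>

lemma eta_in_homset: "M \<in> Ob A \<Longrightarrow> \<eta> M \<in> homset A (ob_map F (ob_map G M)) M"
  using FG.eps_in_homset by (simp add: comp_fun_simps)

lemma rho_in_homset: "N \<in> Ob B \<Longrightarrow> \<rho> N \<in> homset B (ob_map G (ob_map F N)) N"
  using GF.eps_in_homset by (simp add: comp_fun_simps)

lemma local_object_F':
  assumes M: "FG.local_object M"
  shows "GF.local_object (ob_map F' M)"
proof -
  have MO: "M \<in> Ob A" using M by (simp add: FG.local_object_def)
  have "bij_betw (\<lambda>f. f \<cdot>\<^bsub>B\<^esub> \<rho> N) (homset B N (ob_map F' M))
      (homset B (ob_map G (ob_map F N)) (ob_map F' M))" if N: "N \<in> Ob B" for N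
  proof -
    let ?N' = "ob_map G (ob_map F N)"
    have N': "?N' \<in> Ob B" using F.L_Ob G.L_Ob N by blast
    \<comment> \<open>Locality of \<open>M\<close> is used at the object \<open>F N\<close>,
      followed by transposition.\<close>
    have "bij_betw (\<phi> ?N' M \<circ> (\<lambda>f. f \<cdot>\<^bsub>A\<^esub> \<eta> (ob_map F N))) (homset A (ob_map F N) M)
        (homset B ?N' (ob_map F' M))"
      using bij_betw_trans F.bij_phi[OF N' MO] M F.L_Ob[OF N]
      unfolding FG.local_object_def by (fastforce simp: comp_fun_simps)
    moreover have "\<phi> ?N' M (f \<cdot>\<^bsub>A\<^esub> \<eta> (ob_map F N)) = \<phi> N M f \<cdot>\<^bsub>B\<^esub> \<rho> N"
      if f: "f \<in> homset A (ob_map F N) M" for f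
      using F.phi_left[OF rho_in_homset[OF N] f] F_rho[OF N] by simp
    ultimately have "bij_betw ((\<lambda>f. f \<cdot>\<^bsub>B\<^esub> \<rho> N) \<circ> \<phi> N M) (homset A (ob_map F N) M)
        (homset B ?N' (ob_map F' M))"
      by (subst bij_betw_cong[where g = "\<phi> ?N' M \<circ> (\<lambda>f. f \<cdot>\<^bsub>A\<^esub> \<eta> (ob_map F N))"]) auto
    \<comment> \<open>In the rewritten composite the inner map \<open>\<phi> N M\<close> is
      bijective, hence so is the outer one.\<close>
    then show ?thesis using bij_betw_comp_iff[OF F.bij_phi[OF N MO]] by blast
  qed
  then show ?thesis using F.R_Ob[OF MO] by (simp add: GF.local_object_def comp_fun_simps)
qed

text \<open>The image of \<open>\<eta> M\<close> under
  \<open>Hom(FGM, M) = Hom(GM, F'M) = Hom(M, G'F'M)\<close>.\<close>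

definition mate :: "'o \<Rightarrow> 'm" where
  "mate M = \<psi> M (ob_map F' M) (\<phi> (ob_map G M) M (\<eta> M))"

lemma mate_in_homset:
  assumes "M \<in> Ob A"
  shows "mate M \<in> homset A M (ob_map G' (ob_map F' M))"
  using assms F.phi_in_homset G.phi_in_homset G.L_Ob eta_in_homset by (simp add: mate_def)

text \<open>Naturality of \<open>\<psi>\<close> and \<open>\<phi>\<close> in the first variable
  carries \<open>f\<close> inside as \<open>FG f\<close>, and naturality of \<open>\<eta>\<close>
  turns it into precomposition with \<open>\<eta> N\<close>.\<close>

lemma mate_Comp:
  assumes f: "f \<in> homset A N M"
  shows "mate M \<cdot>\<^bsub>A\<^esub> f = \<psi> N (ob_map F' M) (\<phi> (ob_map G N) M (f \<cdot>\<^bsub>A\<^esub> \<eta> N))"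
proof -
  have M: "M \<in> Ob A" using A.Ob_of_homset f by blast
  note Gf = is_functor_homset[OF G.functor_L f]
  have "mate M \<cdot>\<^bsub>A\<^esub> f = \<psi> N (ob_map F' M) (\<phi> (ob_map G M) M (\<eta> M) \<cdot>\<^bsub>B\<^esub> arr_map G f)"
    using G.phi_left[OF f F.phi_in_homset[OF G.L_Ob[OF M] eta_in_homset[OF M]]]
    by (simp add: mate_def)
  also have "\<dots> = \<psi> N (ob_map F' M) (\<phi> (ob_map G N) M (\<eta> M \<cdot>\<^bsub>A\<^esub> arr_map F (arr_map G f)))"
    using F.phi_left[OF Gf eta_in_homset[OF M]] by simp
  also have "\<eta> M \<cdot>\<^bsub>A\<^esub> arr_map F (arr_map G f) = f \<cdot>\<^bsub>A\<^esub> \<eta> N"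
    using FG.eps_natural[OF f] by (simp add: comp_fun_simps)
  finally show ?thesis .
qed

text \<open>Both sides are the double transpose of \<open>f \<cdot> \<eta> N\<close>: the left by
  \<open>mate_Comp\<close>, the right by naturality of \<open>\<phi>\<close> and
  \<open>\<psi>\<close> in the second variable.\<close>

lemma mate_natural:
  assumes f: "f \<in> homset A N M"
  shows "mate M \<cdot>\<^bsub>A\<^esub> f = arr_map G' (arr_map F' f) \<cdot>\<^bsub>A\<^esub> mate N"
proof -
  have N: "N \<in> Ob A" using A.Ob_of_homset f by blast
  note GN = G.L_Ob[OF N] and etaN = eta_in_homset[OF N]
  show ?thesis
    using mate_Comp[OF f] F.phi_right[OF GN f etaN]
      G.phi_right[OF N is_functor_homset[OF F.functor_R f] F.phi_in_homset[OF GN etaN]]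
    by (simp add: mate_def)
qed

lemma iso_mate:
  assumes M: "FG.local_object M"
  shows "iso_arr A (mate M)"
proof -
  have MO: "M \<in> Ob A" using M by (simp add: FG.local_object_def)
  note F'M = F.R_Ob[OF MO]
  show ?thesis
  proof (rule A.iso_arrI_bij_postcomposition[OF mate_in_homset[OF MO]])
    fix N assume N: "N \<in> Ob A"
    have b1: "bij_betw (\<lambda>f. f \<cdot>\<^bsub>A\<^esub> \<eta> N) (homset A N M) (homset A (ob_map F (ob_map G N)) M)"
      using M N by (simp add: FG.local_object_def comp_fun_simps)
    \<comment> \<open>Three bijections in a row: locality of \<open>M\<close>, then the two
      adjunctions. By \<open>mate_Comp\<close> their composite is postcomposition with the
      mate.\<close>
    have "bij_betw (\<psi> N (ob_map F' M) \<circ> (\<phi> (ob_map G N) M \<circ> (\<lambda>f. f \<cdot>\<^bsub>A\<^esub> \<eta> N)))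
        (homset A N M) (homset A N (ob_map G' (ob_map F' M)))"
      using bij_betw_trans[OF bij_betw_trans[OF b1 F.bij_phi[OF G.L_Ob[OF N] MO]]
          G.bij_phi[OF N F'M]] .
    then show "bij_betw (\<lambda>g. mate M \<cdot>\<^bsub>A\<^esub> g) (homset A N M)
        (homset A N (ob_map G' (ob_map F' M)))"
      by (subst bij_betw_cong[OF mate_Comp]) (auto simp: comp_def)
  qed
qed

lemma F'_closed:
  assumes "M \<in> closed_objects A (annihilated_class A \<eta>)"
  shows "ob_map F' M \<in> closed_objects B (annihilated_class B \<rho>)"
  using assms local_object_F' FG.closed_iff_local GF.closed_iff_local by blast

lemma is_functor_F'_closed:
  "is_functor (full_subcategory A (closed_objects A (annihilated_class A \<eta>)))
    (full_subcategory B (closed_objects B (annihilated_class B \<rho>))) F'"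
  using is_functor_full_subcategory[OF F.functor_R] F'_closed A.category_axioms by blast

text \<open>The hypothesis is the mirror image of \<open>F'_closed\<close>; it becomes available
  once the locale is interpreted with the categories exchanged.\<close>

lemma nat_isomorphic_G'_F'_closed:
  assumes G'_closed: "\<And>N. N \<in> closed_objects B (annihilated_class B \<rho>)
      \<Longrightarrow> ob_map G' N \<in> closed_objects A (annihilated_class A \<eta>)"
  shows "nat_isomorphic (full_subcategory A (closed_objects A (annihilated_class A \<eta>)))
    (full_subcategory A (closed_objects A (annihilated_class A \<eta>))) (G' \<circ>\<^sub>F F') id_fun"
proof (rule A.nat_isomorphic_full_subcategoryI[where \<tau> = mate])
  show "is_functor A A (G' \<circ>\<^sub>F F')"
    using is_functor_comp_fun[OF F.functor_R G.functor_R] .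
qed (use mate_in_homset mate_natural iso_mate FG.closed_iff_local F'_closed G'_closed
    in \<open>auto simp: comp_fun_simps\<close>)

end

section \<open>Assembly of the equivalence\<close>

lemma adjunction_of_right_adjoint:
  assumes "category C" "category D" "is_functor C D L" "is_functor D C R" "right_adjoint C D L R"
  obtains \<phi> where "adjunction C D L R \<phi>"
proof -
  interpret C: category C by fact
  interpret D: category D by fact
  obtain \<phi> where bij: "\<forall>x \<in> Ob C. \<forall>y \<in> Ob D.
            bij_betw (\<phi> x y) (homset D (ob_map L x) y) (homset C x (ob_map R y))"
    and nat: "\<forall>x \<in> Ob C. \<forall>x' \<in> Ob C. \<forall>y \<in> Ob D. \<forall>y' \<in> Ob D.
            \<forall>h \<in> homset C x' x. \<forall>g \<in> homset D y y'. \<forall>f \<in> homset D (ob_map L x) y.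
              \<phi> x' y' (g \<cdot>\<^bsub>D\<^esub> f \<cdot>\<^bsub>D\<^esub> arr_map L h) = arr_map R g \<cdot>\<^bsub>C\<^esub> \<phi> x y f \<cdot>\<^bsub>C\<^esub> h"
    using assms(5) unfolding right_adjoint_def by blast
  have "adjunction C D L R \<phi>"
  proof
    show "\<phi> x' y' (g \<cdot>\<^bsub>D\<^esub> f \<cdot>\<^bsub>D\<^esub> arr_map L h) = arr_map R g \<cdot>\<^bsub>C\<^esub> \<phi> x y f \<cdot>\<^bsub>C\<^esub> h"
      if "h \<in> homset C x' x" "g \<in> homset D y y'" "f \<in> homset D (ob_map L x) y" for h x' x g y y' f
      using nat that C.Ob_of_homset[OF that(1)] D.Ob_of_homset[OF that(2)] by blast
  qed (use assms bij in auto)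
  then show ?thesis by (rule that)
qed

theorem theorem3p8:
  fixes A :: "('o, 'm) cat" and B :: "('p, 'n) cat"
    and F :: "('p, 'n, 'o, 'm) fun_data" and G :: "('o, 'm, 'p, 'n) fun_data"
    and F' :: "('o, 'm, 'p, 'n) fun_data" and G' :: "('p, 'n, 'o, 'm) fun_data"
    and \<eta> :: "'o \<Rightarrow> 'm" and \<rho> :: "'p \<Rightarrow> 'n"
  assumes "right_wide_Morita_context A B F G \<eta> \<rho>"
    and "additive_functor A B F'" and "right_adjoint B A F F'"
    and "additive_functor B A G'" and "right_adjoint A B G G'"
  shows "equivalence_via
    (full_subcategory A (closed_objects A (annihilated_class A \<eta>)))
    (full_subcategory B (closed_objects B (annihilated_class B \<rho>)))
    F' G'"
proof -
  interpret right_wide_Morita_context A B F G \<eta> \<rho> by fact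
  have functors: "is_functor B A F" "is_functor A B G" "is_functor A B F'" "is_functor B A G'"
    using assms right_exact_F right_exact_G
    by (auto simp: right_exact_functor_def additive_functor_def)
  obtain \<phi> where "adjunction B A F F' \<phi>"
    using adjunction_of_right_adjoint[OF B.category_axioms A.category_axioms functors(1,3) assms(3)] .
  then interpret F: adjunction B A F F' \<phi> .
  obtain \<psi> where "adjunction A B G G' \<psi>"
    using adjunction_of_right_adjoint[OF A.category_axioms B.category_axioms functors(2,4) assms(5)] .
  then interpret G: adjunction A B G G' \<psi> .
  interpret L: adjoint_Morita_context A B F G \<eta> \<rho> F' G' \<phi> \<psi> by unfold_locales
  \<comment> \<open>The same context with the roles exchanged: it yields that \<open>G'\<close>
    preserves closed objects, and the isomorphism between \<open>F'G'\<close> and the identity on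
    the closed objects of \<open>B\<close>.\<close>
  interpret R: adjoint_Morita_context B A G F \<rho> \<eta> G' F' \<psi> \<phi>
    by unfold_locales (fact right_exact_F right_exact_G nat_eta nat_rho | simp add: G_eta F_rho)+
  show ?thesis
    unfolding equivalence_via_def
    using L.is_functor_F'_closed R.is_functor_F'_closed
      L.nat_isomorphic_G'_F'_closed[OF R.F'_closed] R.nat_isomorphic_G'_F'_closed[OF L.F'_closed]
    by blast
qed

end
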